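(* Let $(X,\|\cdot\|,\succcurlyeq)$ be a regular partially ordered Banach space. Let $D$ be a closed inductive subset of $X$. Let $F: D\to D$ be a $\succcurlyeq$-increasing single-valued mapping. Suppose that there is $x_0\in D$ satisfying $x_0\preccurlyeq Fx_0$. Let $\mathcal{F}(F)=\{x\in D: Fx=x\}$ be the set of fixed points of $F$. Then (a) $\mathcal{F}(F)$ is a nonempty inductive subset of $D$; (b) $\mathcal{F}(F)\cap[x_0)$ is a nonempty inductive subset of $D$.
   Context: For a partial order $\succcurlyeq$ on $X$ write $[u)=\{x\in X: x\succcurlyeq u\}$ and $(w]=\{x\in X: x\preccurlyeq w\}$. A partially ordered Banach space $(X,\|\cdot\|,\succcurlyeq)$ is a real Banach space $X$ with a partial order $\succcurlyeq$ such that: (1) $x\succcurlyeq y$ implies $x+z\succcurlyeq y+z$ for all $x,y,z\in X$; (2) $x\succcurlyeq y$ implies $\alpha x\succcurlyeq\alpha y$ for all $x,y\in X$ and $\alpha\ge 0$; (3) there are distinct $x,y\in X$ with $x\succcurlyeq y$; and for every $u\in X$ the sets $[u)$ and $(u]$ are norm-closed. It is called regular if every $\succcurlyeq$-increasing sequence that has a $\succcurlyeq$-upper bound in $X$ is norm-convergent, i.e. $x_1\preccurlyeq x_2\preccurlyeq\cdots\preccurlyeq y$ for some $y\in X$ implies that there is $x\in X$ with $\|x_n-x\|\to 0$. A chain is a nonempty totally ordered subset. A subset $A\subseteq X$ is inductive if every chain in $A$ has a $\succcurlyeq$-upper bound belonging to $A$. Closed means norm-closed. The mapping $F$ is $\succcurlyeq$-increasing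 if $x\preccurlyeq y$ in $D$ implies $Fx\preccurlyeq Fy$. *)

theory Defs
  imports Complex_Main
begin

text \<open>
  The order is an explicit relation \<open>le\<close> rather than an instance of a type class, so that a
  Banach space type may carry any number of orders; \<open>le x y\<close> reads ``x precedes y''.
\<close>

definition up_set :: "('a \<Rightarrow> 'a \<Rightarrow> bool) \<Rightarrow> 'a \<Rightarrow> 'a set"
  where "up_set le u = {x. le u x}"

definition down_set :: "('a \<Rightarrow> 'a \<Rightarrow> bool) \<Rightarrow> 'a \<Rightarrow> 'a set"
  where "down_set le w = {x. le x w}"

locale po_banach_space =
  fixes le :: "'a::banach \<Rightarrow> 'a \<Rightarrow> bool"
  assumes reflp_le: "reflp le"
    and antisymp_le: "antisymp le"
    and transp_le: "transp le"
    and add_mono: "\<And>x y z. le y x \<Longrightarrow> le (y + z) (x + z)"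
    and scaleR_mono: "\<And>x y a. le y x \<Longrightarrow> 0 \<le> a \<Longrightarrow> le (a *\<^sub>R y) (a *\<^sub>R x)"
    and nontrivial: "\<exists>x y. x \<noteq> y \<and> le y x"
    and closed_up_set: "\<And>u. closed (up_set le u)"
    and closed_down_set: "\<And>u. closed (down_set le u)"

locale regular_po_banach_space = po_banach_space le
  for le :: "'a::banach \<Rightarrow> 'a \<Rightarrow> bool" +
  assumes regular:
    "\<And>(x :: nat \<Rightarrow> 'a) y. (\<And>n. le (x n) (x (Suc n))) \<Longrightarrow> (\<And>n. le (x n) y) \<Longrightarrow> convergent x"

text \<open>
  The library's \<^const>\<open>Complete_Partial_Order.chain\<close> admits the empty set, whereas here
  chains are nonempty, so that the empty set is vacuously inductive.
\<close>

definition inductive_subset :: "('a \<Rightarrow> 'a \<Rightarrow> bool) \<Rightarrow> 'a set \<Rightarrow> bool"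
  where "inductive_subset le A \<longleftrightarrow>
    (\<forall>C. C \<noteq> {} \<and> C \<subseteq> A \<and> Complete_Partial_Order.chain le C \<longrightarrow> (\<exists>b\<in>A. \<forall>x\<in>C. le x b))"

definition fixed_points :: "'a set \<Rightarrow> ('a \<Rightarrow> 'a) \<Rightarrow> 'a set"
  where "fixed_points D F = {x \<in> D. F x = x}"

end

theory Submission
  imports Defs
begin

text \<open>
  Regularity turns a bounded chain \<open>C\<close> into a Cauchy net, since otherwise \<open>C\<close> would contain an
  increasing bounded sequence with jumps bounded away from zero; its limit is the least upper
  bound of \<open>C\<close>. For a chain \<open>C\<close> of points with \<open>c \<preceq> F c\<close>, Zorn's lemma then applies to the
  set of all upper bounds \<open>x\<close> of \<open>C\<close> in \<open>D\<close> with \<open>x \<preceq> F x\<close>, and a maximal element of it is a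
  fixed point of \<open>F\<close>. Both claims follow, with \<open>C = {x\<^sub>0}\<close> giving nonemptiness.
\<close>

context po_banach_space
begin

lemma le_refl: "le x x"
  using reflp_le by (rule reflpD)

lemma le_trans: "le x y \<Longrightarrow> le y z \<Longrightarrow> le x z"
  using transp_le by (rule transpD)

lemma le_antisym: "le x y \<Longrightarrow> le y x \<Longrightarrow> x = y"
  using antisymp_le by (rule antisympD)

lemma le_seq_mono:
  fixes x :: "nat \<Rightarrow> 'a"
  assumes "\<And>n. le (x n) (x (Suc n))" and "m \<le> n"
  shows "le (x m) (x n)"
  using assms(2)
proof (induction rule: dec_induct)
  case base
  show ?case by (rule le_refl)
next
  case (step n)
  from step.IH assms(1) show ?case by (rule le_trans)
qed

lemma le_limit:
  assumes "\<And>n. le (x n) (x (Suc n))" and "x \<longlonglongrightarrow> l"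
  shows "le (x n) l"
proof -
  \<comment> \<open>Only the terms from index \<open>n\<close> on lie in this closed set, which is
    enough to place the limit there.\<close>
  have "\<forall>\<^sub>F k in sequentially. x k \<in> up_set le (x n)"
    using eventually_ge_at_top[of n]
    by eventually_elim (simp add: up_set_def le_seq_mono[of x] assms(1))
  then have "l \<in> up_set le (x n)"
    using Lim_in_closed_set[OF closed_up_set _ _ assms(2)] by simp
  then show ?thesis
    by (simp add: up_set_def)
qed

lemma limit_le:
  assumes "\<And>n. le (x n) y" and "x \<longlonglongrightarrow> l"
  shows "le l y"
  using closed_sequentially[OF closed_down_set, of x y l] assms by (simp add: down_set_def)

end

context regular_po_banach_space
begin

text \<open>Otherwise every element of \<open>C\<close> has a larger one in \<open>C\<close> at
  distance at least \<open>e\<close>. Dependent choice then gives an increasing sequence below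
  \<open>b\<close> that is not Cauchy, against \<open>regular\<close>.\<close>

lemma bounded_set_eventually_close:
  assumes "C \<noteq> {}"
    and bound: "\<And>x. x \<in> C \<Longrightarrow> le x b" and "0 < e"
  shows "\<exists>c\<in>C. \<forall>d\<in>C. le c d \<longrightarrow> dist c d < e"
proof (rule ccontr)
  assume "\<not> ?thesis"
  then have step: "\<exists>d. d \<in> C \<and> le c d \<and> e \<le> dist c d" if "c \<in> C" for c
    using that by force
  have "\<exists>x. \<forall>n. x n \<in> C \<and> (le (x n) (x (Suc n)) \<and> e \<le> dist (x n) (x (Suc n)))"
    using \<open>C \<noteq> {}\<close> step by (intro dependent_nat_choice) auto
  then obtain x where x: "\<And>n. x n \<in> C" "\<And>n. le (x n) (x (Suc n))"
      "\<And>n. e \<le> dist (x n) (x (Suc n))"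
    by auto
  have "Cauchy x"
    by (intro convergent_Cauchy regular[of x b] x(2) bound x(1))
  then obtain N where "\<forall>m\<ge>N. \<forall>n\<ge>N. dist (x m) (x n) < e"
    using \<open>0 < e\<close> metric_CauchyD by blast
  then have "dist (x N) (x (Suc N)) < e"
    by simp
  then show False
    using x(3)[of N] by simp
qed

text \<open>An increasing sequence in \<open>C\<close> is chosen so that all of \<open>C\<close>
  above its \<open>n\<close>-th term is within 1/(n+1) of that term. Its limit is the least upper
  bound, and it stays in \<open>D\<close> because \<open>D\<close> is closed.\<close>

lemma chain_has_lub_in_closed:
  assumes chain: "Complete_Partial_Order.chain le C" and "C \<noteq> {}"
    and bound: "\<And>x. x \<in> C \<Longrightarrow> le x b"
    and "C \<subseteq> D" and "closed D"
  obtains s where "s \<in> D" "\<And>x. x \<in> C \<Longrightarrow> le x s"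
    "\<And>y. (\<And>x. x \<in> C \<Longrightarrow> le x y) \<Longrightarrow> le s y"
proof -
  define close where "close n c \<longleftrightarrow> (\<forall>d\<in>C. le c d \<longrightarrow> dist c d < inverse (real (Suc n)))" for n c
  \<comment> \<open>The elements with \<open>close n\<close> are cofinal in \<open>C\<close>: the
    larger of \<open>c\<close> and a suitable \<open>a\<close> qualifies. The radius at
    \<open>a\<close> is halved because distances from \<open>c'\<close> are estimated through
    \<open>a\<close>.\<close>
  have close_upper: "\<exists>c'. (c' \<in> C \<and> close n c') \<and> le c c'" if "c \<in> C" for n c
  proof -
    obtain a where a: "a \<in> C" "\<And>d. d \<in> C \<Longrightarrow> le a d \<Longrightarrow> dist a d < inverse (real (Suc n)) / 2"
      using bounded_set_eventually_close[OF \<open>C \<noteq> {}\<close> bound, of "inverse (real (Suc n)) / 2"] by auto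
    have "le a c \<or> le c a"
      using chain a(1) \<open>c \<in> C\<close> by (simp add: chain_def)
    then obtain c' where c': "c' \<in> C" "le a c'" "le c c'"
      using a(1) \<open>c \<in> C\<close> le_refl by blast
    have "close n c'"
      unfolding close_def
    proof (intro ballI impI)
      fix d assume "d \<in> C" "le c' d"
      then have "le a d"
        using le_trans[OF c'(2)] by blast
      show "dist c' d < inverse (real (Suc n))"
        by (rule dist_triangle_half_r) (fact a(2)[OF c'(1,2)] a(2)[OF \<open>d \<in> C\<close> \<open>le a d\<close>])+
    qed
    then show ?thesis
      using c' by blast
  qed
  have "\<exists>x. \<forall>n. (x n \<in> C \<and> close n (x n)) \<and> le (x n) (x (Suc n))"
  proof (rule dependent_nat_choice)
    show "\<exists>c. c \<in> C \<and> close 0 c"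
      using \<open>C \<noteq> {}\<close> close_upper[of _ 0] by blast
    show "\<exists>c'. (c' \<in> C \<and> close (Suc n) c') \<and> le c c'" if "c \<in> C \<and> close n c" for c n
      using close_upper[of c "Suc n"] that by blast
  qed
  then obtain x where x: "\<And>n. x n \<in> C" "\<And>n. close n (x n)" "\<And>n. le (x n) (x (Suc n))"
    by auto
  have "convergent x"
    by (intro regular[of x b] x(3) bound x(1))
  then obtain s where s: "x \<longlonglongrightarrow> s"
    by (auto simp: convergent_def)
  show thesis
  proof
    show "s \<in> D"
      using closed_sequentially[OF \<open>closed D\<close> _ s] x(1) \<open>C \<subseteq> D\<close> by auto
  next
    fix y assume y: "y \<in> C"
    show "le y s"
    proof (cases "\<exists>n. le y (x n)")
      case True
      then show ?thesis
        using le_limit[OF x(3) s] le_trans by blast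
    next
      \<comment> \<open>By totality \<open>y\<close> now lies above every \<open>x n\<close>, so
        closeness squeezes the distances to zero and \<open>y\<close> is the limit itself.\<close>
      case False
      then have "le (x n) y" for n
        using chain y x(1) unfolding chain_def by blast
      then have "dist (x n) y \<le> inverse (real (Suc n))" for n
        using x(2)[of n] y unfolding close_def by fastforce
      then have "(\<lambda>n. dist (x n) y) \<longlonglongrightarrow> 0"
        by (intro tendsto_sandwich[OF _ _ tendsto_const LIMSEQ_inverse_real_of_nat]) auto
      then have "x \<longlonglongrightarrow> y"
        by (rule iffD2[OF tendsto_dist_iff])
      then have "y = s"
        using s by (rule LIMSEQ_unique)
      then show ?thesis
        by (simp add: le_refl)
    qed
  next
    fix y assume "\<And>x. x \<in> C \<Longrightarrow> le x y"
    then show "le s y"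
      using limit_le[OF _ s] x(1) by blast
  qed
qed

text \<open>Inductivity of \<open>D\<close> supplies some bound, and the least upper bound
  \<open>s\<close> replaces it: \<open>c \<le> F c \<le> F s\<close> makes \<open>F s\<close> an
  upper bound of \<open>C\<close>, so leastness gives \<open>s \<le> F s\<close>.\<close>

lemma post_fixed_upper_bound:
  assumes D: "closed D" "inductive_subset le D"
    and F: "F ` D \<subseteq> D" "monotone_on D le le F"
    and C: "C \<noteq> {}" "C \<subseteq> D" "Complete_Partial_Order.chain le C" "\<And>c. c \<in> C \<Longrightarrow> le c (F c)"
  obtains s where "s \<in> D" "le s (F s)" "\<And>c. c \<in> C \<Longrightarrow> le c s"
proof -
  obtain b where "\<And>c. c \<in> C \<Longrightarrow> le c b"
    using D(2) C(1-3) unfolding inductive_subset_def by metis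
  then obtain s where s: "s \<in> D" "\<And>x. x \<in> C \<Longrightarrow> le x s"
      "\<And>y. (\<And>x. x \<in> C \<Longrightarrow> le x y) \<Longrightarrow> le s y"
    using chain_has_lub_in_closed[OF C(3,1) _ C(2) D(1)] by metis
  have "le c (F s)" if "c \<in> C" for c
    using monotone_onD[OF F(2), of c s] that C(2,4) s(1,2) le_trans by blast
  then show thesis
    using that s by blast
qed

text \<open>Asking for \<open>le c (F c)\<close> instead of \<open>F c = c\<close> lets one
  statement serve both chains of fixed points and the singleton of the starting point.\<close>

lemma fixed_point_above_chain:
  assumes D: "closed D" "inductive_subset le D"
    and F: "F ` D \<subseteq> D" "monotone_on D le le F"
    and C: "C \<noteq> {}" "C \<subseteq> D" "Complete_Partial_Order.chain le C" "\<And>c. c \<in> C \<Longrightarrow> le c (F c)"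
  shows "\<exists>z\<in>fixed_points D F. \<forall>c\<in>C. le c z"
proof -
  define Z where "Z = {x \<in> D. le x (F x) \<and> (\<forall>c\<in>C. le c x)}"
  obtain s where "s \<in> D" "le s (F s)" "\<And>c. c \<in> C \<Longrightarrow> le c s"
    by (rule post_fixed_upper_bound[OF D F C]) (assumption, rule that)
  then have "Z \<noteq> {}"
    unfolding Z_def by blast
  have "partial_order_on Z (relation_of le Z)"
    by (intro partial_order_on_relation_ofI) (rule le_refl, erule (1) le_trans, erule (1) le_antisym)
  moreover have "\<exists>u\<in>Z. \<forall>a\<in>K. le a u" if K: "K \<in> Chains (relation_of le Z)" for K
  proof (cases "K = {}")
    case True
    then show ?thesis
      using \<open>Z \<noteq> {}\<close> by blast
  next
    case False
    have KZ: "K \<subseteq> Z" and chain: "Complete_Partial_Order.chain le K"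
      using K by (auto simp: Chains_def relation_of_def chain_def)
    have K': "K \<subseteq> D" "\<And>k. k \<in> K \<Longrightarrow> le k (F k)"
      using KZ unfolding Z_def by auto
    obtain s where s: "s \<in> D" "le s (F s)" "\<And>k. k \<in> K \<Longrightarrow> le k s"
      by (rule post_fixed_upper_bound[OF D F False K'(1) chain K'(2)]) (assumption, rule that)
    \<comment> \<open>Any element of the nonempty \<open>K\<close> lies between \<open>C\<close> and
      \<open>s\<close>, so \<open>s\<close> bounds \<open>C\<close> as well.\<close>
    have "s \<in> Z"
      using s False KZ le_trans unfolding Z_def by blast
    then show ?thesis
      using s(3) by blast
  qed
  ultimately obtain m where m: "m \<in> Z" "\<And>a. a \<in> Z \<Longrightarrow> le m a \<Longrightarrow> a = m"
    using predicate_Zorn[of Z le] by blast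
  then have mD: "m \<in> D" "le m (F m)" "F m \<in> D"
    using F(1) by (auto simp: Z_def)
  \<comment> \<open>Monotonicity turns \<open>m \<le> F m\<close> into
    \<open>F m \<le> F (F m)\<close>, and \<open>F m\<close> inherits the bound on \<open>C\<close>
    from \<open>m\<close>; maximality of \<open>m\<close> then applies to
    \<open>F m\<close>.\<close>
  have "F m \<in> Z"
    using m(1) mD monotone_onD[OF F(2) mD(1,3,2)] le_trans unfolding Z_def by blast
  then have "F m = m"
    using m(2) mD(2) by blast
  then show ?thesis
    using m(1) by (auto simp: Z_def fixed_points_def)
qed

end

theorem corollary3p10:
  fixes le :: "'a::banach \<Rightarrow> 'a \<Rightarrow> bool"
    and D :: "'a set"
    and F :: "'a \<Rightarrow> 'a"
    and x\<^sub>0 :: 'a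
  assumes "regular_po_banach_space le"
    and "closed D"
    and "inductive_subset le D"
    and "F ` D \<subseteq> D"
    and "monotone_on D le le F"
    and "x\<^sub>0 \<in> D"
    and "le x\<^sub>0 (F x\<^sub>0)"
  shows "(fixed_points D F \<noteq> {} \<and> fixed_points D F \<subseteq> D \<and>
            inductive_subset le (fixed_points D F)) \<and>
         (fixed_points D F \<inter> up_set le x\<^sub>0 \<noteq> {} \<and> fixed_points D F \<inter> up_set le x\<^sub>0 \<subseteq> D \<and>
            inductive_subset le (fixed_points D F \<inter> up_set le x\<^sub>0))"
proof -
  interpret regular_po_banach_space le
    by fact
  note above = fixed_point_above_chain[OF assms(2-5)]
  have fix_above: "\<exists>z\<in>fixed_points D F. \<forall>c\<in>C. le c z"
    if "C \<noteq> {}" "C \<subseteq> fixed_points D F" "Complete_Partial_Order.chain le C" for C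
    using that by (intro above) (auto simp: fixed_points_def subset_iff le_refl)
  have "\<exists>z\<in>fixed_points D F. \<forall>c\<in>{x\<^sub>0}. le c z"
    using assms(6,7) by (intro above) (auto simp: chain_def le_refl)
  then have "fixed_points D F \<inter> up_set le x\<^sub>0 \<noteq> {}"
    by (auto simp: up_set_def)
  moreover have "inductive_subset le (fixed_points D F)"
    unfolding inductive_subset_def using fix_above by blast
  moreover have "inductive_subset le (fixed_points D F \<inter> up_set le x\<^sub>0)"
    unfolding inductive_subset_def
  proof (intro allI impI, elim conjE)
    fix C
    assume C: "C \<noteq> {}" "C \<subseteq> fixed_points D F \<inter> up_set le x\<^sub>0" "Complete_Partial_Order.chain le C"
    then obtain z where z: "z \<in> fixed_points D F" "\<forall>c\<in>C. le c z"
      using fix_above[of C] by auto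
    \<comment> \<open>Nonemptiness of \<open>C\<close> matters here: some \<open>c\<close> in
      \<open>C\<close> links \<open>x\<^sub>0\<close> to \<open>z\<close>.\<close>
    then have "le x\<^sub>0 z"
      using C(1,2) le_trans unfolding up_set_def by blast
    then show "\<exists>b\<in>fixed_points D F \<inter> up_set le x\<^sub>0. \<forall>x\<in>C. le x b"
      using z by (auto simp: up_set_def)
  qed
  ultimately show ?thesis
    by (auto simp: fixed_points_def)
qed

end
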